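(* Let $R$ be a commutative ring with identity containing $\mathbb{Q}$, let $N\ge2$, and let $c\in R$. Let $\mathcal{P}_N=R[X_1,\ldots,X_N]$, let $\mathcal{H}_N=\ker\Delta_N\subset\mathcal{P}_N$ be the $R$-submodule of harmonic polynomials, and let $\mathcal{Z}_N(c)$ be the ideal of $\mathcal{P}_N$ generated by $X_1^2+\cdots+X_N^2-c$. Then the inclusion map $\mathcal{H}_N\to\mathcal{P}_N$ induces an isomorphism of $R$-modules $$H_c\colon\mathcal{H}_N\to\mathcal{P}_N/\mathcal{Z}_N(c),\qquad H_c(p)=p+\mathcal{Z}_N(c).$$ Moreover, there is a unique $R$-linear map $L_c\colon\mathcal{P}_N\to\mathcal{H}_N$ that restricts to the identity map on $\mathcal{H}_N$ and is $0$ on $\mathcal{Z}_N(c)$. Furthermore: (i) $\ker L_c=\mathcal{Z}_N(c)$; (ii) $H_c\circ L_c$ is the projection map $\mathcal{P}_N\to\mathcal{P}_N/\mathcal{Z}_N(c)$; (iii) $L_c$ commutes with each operator $M_{jk}$, $j\ne k$.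
   Context: $\Delta_N=\partial_1^2+\cdots+\partial_N^2$ with $\partial_j=\partial/\partial X_j$; $M_{jk}=X_j\partial_k-X_k\partial_j$ for distinct $j,k\in\{1,\ldots,N\}$. These are operators on $R[X_1,\ldots,X_N]$. *)

theory Defs
  imports Complex_Main "HOL-Library.Cardinality" "HOL-Library.Poly_Mapping"
    "HOL-Library.Set_Algebras"
begin

section \<open>Polynomials\<close>

text \<open>
  Polynomials over \<^typ>\<open>'a\<close> in finitely many variables indexed by \<^typ>\<open>'n\<close>: a monomial is its
  exponent vector \<^typ>\<open>'n \<Rightarrow>\<^sub>0 nat\<close>, and a polynomial is a finitely supported family of
  coefficients.  The number of variables is \<open>CARD('n)\<close>.  Poly_Mapping supplies the
  commutative ring structure (convolution product).
\<close>

type_synonym ('n, 'a) mpoly = "('n \<Rightarrow>\<^sub>0 nat) \<Rightarrow>\<^sub>0 'a"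

definition Const :: "'a::comm_ring_1 \<Rightarrow> ('n, 'a) mpoly" where
  "Const r = Poly_Mapping.single 0 r"

definition Var :: "'n \<Rightarrow> ('n, 'a::comm_ring_1) mpoly" where
  "Var j = Poly_Mapping.single (Poly_Mapping.single j 1) 1"

definition scale :: "'a::comm_ring_1 \<Rightarrow> ('n, 'a) mpoly \<Rightarrow> ('n, 'a) mpoly" where
  "scale r p = Const r * p"

text \<open>
  Formal partial derivative.  The subtraction of exponent vectors is truncated, which is
  harmless: when the exponent of variable \<open>j\<close> is \<open>0\<close>, the coefficient is \<open>0\<close>.
\<close>

definition pd :: "'n \<Rightarrow> ('n, 'a::comm_ring_1) mpoly \<Rightarrow> ('n, 'a) mpoly" where
  "pd j p = (\<Sum>m\<in>Poly_Mapping.keys p.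
     Poly_Mapping.single (m - Poly_Mapping.single j 1)
       (of_nat (Poly_Mapping.lookup m j) * Poly_Mapping.lookup p m))"

definition laplacian :: "('n::finite, 'a::comm_ring_1) mpoly \<Rightarrow> ('n, 'a) mpoly" where
  "laplacian p = (\<Sum>j\<in>UNIV. pd j (pd j p))"

definition M_op :: "'n \<Rightarrow> 'n \<Rightarrow> ('n, 'a::comm_ring_1) mpoly \<Rightarrow> ('n, 'a) mpoly" where
  "M_op j k p = Var j * pd k p - Var k * pd j p"

definition harmonic :: "('n::finite, 'a::comm_ring_1) mpoly set" where
  "harmonic = {p. laplacian p = 0}"

text \<open>
  The ideal generated by \<open>X\<^sub>1\<^sup>2 + \<dots> + X\<^sub>N\<^sup>2 - c\<close>: ideals are the submodules of the ring
  regarded as a module over itself.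
\<close>

definition sphere_ideal :: "'a::comm_ring_1 \<Rightarrow> ('n::finite, 'a) mpoly set" where
  "sphere_ideal c = module.span (*) {(\<Sum>j\<in>UNIV. Var j ^ 2) - Const c}"

section \<open>Coefficient rings containing the rationals\<close>

definition rat_embedding :: "(rat \<Rightarrow> 'a::comm_ring_1) \<Rightarrow> bool" where
  "rat_embedding \<phi> \<longleftrightarrow> inj \<phi> \<and> \<phi> 1 = 1 \<and>
     (\<forall>x y. \<phi> (x + y) = \<phi> x + \<phi> y) \<and> (\<forall>x y. \<phi> (x * y) = \<phi> x * \<phi> y)"

section \<open>Quotient modules and isomorphisms\<close>

text \<open>
  The quotient by \<open>Z\<close> is the set of cosets \<open>p +o Z\<close>, and cosets are added elementwise with \<open>+\<close>
  on sets from Set_Algebras.  Elementwise scaling of a coset need not give a coset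
  (consider the scalar \<open>0\<close>), so \<open>Z\<close> is added back.
\<close>

definition cosets :: "'b::ab_group_add set \<Rightarrow> 'b set set" where
  "cosets Z = {p +o Z | p. True}"

definition coset_scale ::
    "('a \<Rightarrow> 'b \<Rightarrow> 'b) \<Rightarrow> 'b::ab_group_add set \<Rightarrow> 'a \<Rightarrow> 'b set \<Rightarrow> 'b set" where
  "coset_scale s Z r A = (\<Union>a\<in>A. s r a +o Z)"

text \<open>
  An isomorphism from the module with carrier \<open>A\<close> and scaling \<open>s\<close> to the one with carrier
  \<open>B\<close> and scaling \<open>t\<close>; addition is the overloaded \<open>+\<close> on both sides.
\<close>

definition module_iso_on ::
    "('a \<Rightarrow> 'b \<Rightarrow> 'b) \<Rightarrow> 'b set \<Rightarrow> ('a \<Rightarrow> 'c \<Rightarrow> 'c) \<Rightarrow> 'c set \<Rightarrow> ('b::plus \<Rightarrow> 'c::plus) \<Rightarrow> bool"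
  where
  "module_iso_on s A t B f \<longleftrightarrow> bij_betw f A B \<and>
     (\<forall>x\<in>A. \<forall>y\<in>A. f (x + y) = f x + f y) \<and>
     (\<forall>r. \<forall>x\<in>A. f (s r x) = t r (f x))"

text \<open>The class map; its restriction to the harmonic polynomials is \<open>H\<^sub>c\<close>.\<close>

definition H_map :: "'a::comm_ring_1 \<Rightarrow> ('n::finite, 'a) mpoly \<Rightarrow> ('n, 'a) mpoly set" where
  "H_map c p = p +o sphere_ideal c"

text \<open>The defining property of \<open>L\<^sub>c\<close>, viewed as a map into all polynomials with harmonic values.\<close>

definition harmonic_projection ::
    "'a::comm_ring_1 \<Rightarrow> (('n::finite, 'a) mpoly \<Rightarrow> ('n, 'a) mpoly) \<Rightarrow> bool" where
  "harmonic_projection c L \<longleftrightarrow> module_hom scale scale L \<and> (\<forall>p. L p \<in> harmonic) \<and>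
     (\<forall>p\<in>harmonic. L p = p) \<and> (\<forall>p\<in>sphere_ideal c. L p = 0)"

section \<open>Basic facts\<close>

lemma module_times: "module ((*) :: 'b::comm_ring_1 \<Rightarrow> 'b \<Rightarrow> 'b)"
  by unfold_locales (simp_all add: algebra_simps)

lemma Const_add: "Const (r + s) = Const r + Const s"
  by (simp add: Const_def single_add)

lemma Const_mult: "Const (r * s) = Const r * Const s"
  by (simp add: Const_def mult_single)

lemma Const_1: "Const 1 = 1"
  by (simp add: Const_def)

lemma module_scale: "module (scale :: 'a::comm_ring_1 \<Rightarrow> ('n, 'a) mpoly \<Rightarrow> _)"
  by unfold_locales (simp_all add: scale_def Const_add Const_mult Const_1 algebra_simps)

lemma pd_superset:
  assumes "finite S" "Poly_Mapping.keys p \<subseteq> S"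
  shows "pd j p = (\<Sum>m\<in>S. Poly_Mapping.single (m - Poly_Mapping.single j 1)
     (of_nat (Poly_Mapping.lookup m j) * Poly_Mapping.lookup p m))"
  unfolding pd_def using assms
  by (intro sum.mono_neutral_left) (auto simp: in_keys_iff)

lemma pd_add: "pd j (p + q) = pd j p + pd j q"
proof -
  let ?S = "Poly_Mapping.keys p \<union> Poly_Mapping.keys q"
  have "finite ?S" "Poly_Mapping.keys (p + q) \<subseteq> ?S"
    by (auto dest: subsetD[OF Poly_Mapping.keys_add])
  then show ?thesis
    by (simp add: pd_superset[of ?S] lookup_add distrib_left single_add sum.distrib)
qed

lemma pd_single: "pd j (Poly_Mapping.single m a) =
    Poly_Mapping.single (m - Poly_Mapping.single j 1) (of_nat (Poly_Mapping.lookup m j) * a)"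
  by (subst pd_superset[of "{m}"]) auto

lemma pd_zero [simp]: "pd j 0 = 0"
  by (simp add: pd_def)

lemma pd_Const: "pd j (Const r) = 0"
  by (simp add: Const_def pd_single)

lemma pd_Var: "pd j (Var k) = (if j = k then 1 else 0)"
  by (auto simp: Var_def pd_single lookup_single)

lemma mpoly_induct [case_names zero add]:
  fixes p :: "('n, 'a::comm_ring_1) mpoly"
  assumes "P 0" and "\<And>m a p. P p \<Longrightarrow> P (Poly_Mapping.single m a + p)"
  shows "P p"
proof (induction p rule: update_induct)
  case const
  then show ?case by (simp add: assms(1))
next
  case (update p m a)
  have "Poly_Mapping.update m a p = Poly_Mapping.single m a + p"
    using update(1)
    by (intro poly_mapping_eqI) (auto simp: lookup_update lookup_add lookup_single in_keys_iff)
  then show ?case using assms(2) update by simp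
qed

lemma pd_mult_single:
  fixes a b :: "'a::comm_ring_1"
  shows "pd j (Poly_Mapping.single m a * Poly_Mapping.single n b) =
    pd j (Poly_Mapping.single m a) * Poly_Mapping.single n b +
    Poly_Mapping.single m a * pd j (Poly_Mapping.single n b)"
proof -
  let ?e = "Poly_Mapping.single j (1::nat)"
  have shift: "(u + v) - ?e = (u - ?e) + v" if "Poly_Mapping.lookup u j \<noteq> 0" for u v
    using that
    by (intro poly_mapping_eqI) (auto simp: lookup_add lookup_minus lookup_single when_def)
  have "Poly_Mapping.single (m + n - ?e) (of_nat (Poly_Mapping.lookup m j) * (a * b)) =
      Poly_Mapping.single (m - ?e + n) (of_nat (Poly_Mapping.lookup m j) * (a * b))"
    using shift[of m n] by (cases "Poly_Mapping.lookup m j = 0") simp_all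
  moreover have
    "Poly_Mapping.single (m + n - ?e) (of_nat (Poly_Mapping.lookup n j) * (a * b)) =
      Poly_Mapping.single (m + (n - ?e)) (of_nat (Poly_Mapping.lookup n j) * (a * b))"
    using shift[of n m]
    by (cases "Poly_Mapping.lookup n j = 0") (simp_all add: add.commute)
  ultimately show ?thesis
    by (simp add: mult_single pd_single lookup_add distrib_left distrib_right single_add ac_simps)
qed

lemma pd_mult:
  fixes p q :: "('n, 'a::comm_ring_1) mpoly"
  shows "pd j (p * q) = pd j p * q + p * pd j q"
proof (induction p rule: mpoly_induct)
  case zero
  then show ?case by simp
next
  case (add m a p)
  have "pd j (Poly_Mapping.single m a * q) =
      pd j (Poly_Mapping.single m a) * q + Poly_Mapping.single m a * pd j q"
    by (induction q rule: mpoly_induct) (simp_all add: distrib_left pd_add pd_mult_single)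
  with add show ?case by (simp add: distrib_right pd_add)
qed

lemma pd_scale: "pd j (scale r p) = scale r (pd j p)"
  by (simp add: scale_def pd_mult pd_Const)

lemma subspace_harmonic: "module.subspace scale harmonic"
  by (simp add: module.subspace_def[OF module_scale] harmonic_def laplacian_def pd_add pd_scale
      sum.distrib module.scale_sum_right[OF module_scale, symmetric]
      module.scale_zero_right[OF module_scale])

lemma sphere_ideal_eq:
  "sphere_ideal c = {q * ((\<Sum>j\<in>UNIV. Var j ^ 2) - Const c) | q. True}"
  by (auto simp: sphere_ideal_def module.span_singleton[OF module_times])

lemma subspace_sphere_ideal: "module.subspace scale (sphere_ideal c)"
  using module.subspace_span[OF module_times]
  by (auto simp: sphere_ideal_def module.subspace_def[OF module_scale]
      module.subspace_def[OF module_times] scale_def)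

lemma coset_add:
  assumes "module s" "module.subspace s Z"
  shows "(p +o Z) + (q +o Z) = (p + q) +o Z"
proof -
  have "Z + Z = Z"
    using module.subspace_0[OF assms] module.subspace_add[OF assms]
    by (force simp: set_plus_def)
  then show ?thesis by (simp add: set_plus_rearrange)
qed

lemma coset_scale_coset:
  assumes "module s" "module.subspace s Z"
  shows "coset_scale s Z r (p +o Z) = s r p +o Z"
proof -
  have "s r (p + z) +o Z = s r p +o Z" if "z \<in> Z" for z
  proof -
    have z: "s r z \<in> Z" using that module.subspace_scale[OF assms] by blast
    have "s r z +o Z = Z"
    proof
      show "s r z +o Z \<subseteq> Z"
        using z module.subspace_add[OF assms] by (auto simp: elt_set_plus_def)
      show "Z \<subseteq> s r z +o Z"
      proof
        fix x assume "x \<in> Z"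
        then have "x - s r z \<in> Z" using z module.subspace_diff[OF assms] by blast
        then show "x \<in> s r z +o Z"
          by (auto simp: elt_set_plus_def intro!: bexI[of _ "x - s r z"])
      qed
    qed
    then show ?thesis
      by (simp add: module.scale_right_distrib[OF assms(1)] set_plus_rearrange2[symmetric])
  qed
  moreover have "Z \<noteq> {}" using module.subspace_0[OF assms] by blast
  ultimately show ?thesis by (auto simp: coset_scale_def elt_set_plus_def[of p])
qed

end

theory Submission
  imports Defs
begin

text \<open>
  Write \<open>g = X\<^sub>1\<^sup>2 + \<dots> + X\<^sub>N\<^sup>2 - c\<close> and let \<open>E\<close> be the Euler operator.  The theorem reduces to
  the bijectivity of \<open>q \<mapsto> \<Delta>(g q)\<close>, which equals \<open>g \<Delta>q + (4E + 2N)q\<close>.  It is proved for all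
  operators \<open>F\<^bsub>b,a\<^esub> = g \<Delta> + bE + a\<close> with \<open>a > 0\<close>, since these satisfy
  \<open>\<Delta> F\<^bsub>b,a\<^esub> = F\<^bsub>b+4,a+2b+2N\<^esub> \<Delta>\<close>, so that one can induct on the number of applications of \<open>\<Delta>\<close>
  that annihilate a polynomial; what remains is \<open>bE + a\<close>, which acts on each monomial as a
  positive integer.
\<close>

section \<open>Calculus of partial derivatives and the Laplacian\<close>

lemma pd_sum: "pd j (\<Sum>i\<in>I. f i) = (\<Sum>i\<in>I. pd j (f i))"
  by (induction I rule: infinite_finite_induct) (simp_all add: pd_add)

lemma pd_uminus: "pd j (- p) = - pd j p"
  by (metis add.right_inverse minus_unique pd_add pd_zero)

lemma pd_diff: "pd j (p - q) = pd j p - pd j q"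
  using pd_add[of j p "- q"] by (simp add: pd_uminus)

lemma pd_of_nat [simp]: "pd j (of_nat k) = 0"
  using pd_Const[of j "of_nat k"] by (simp add: Const_def single_of_nat)

lemma pd_numeral [simp]: "pd j (numeral k) = 0"
  using pd_of_nat[of j "numeral k"] by simp

lemma pd_one [simp]: "pd j 1 = 0"
  using pd_of_nat[of j 1] by simp

lemma pd_commute: "pd j (pd k p) = pd k (pd j p)"
proof (induction p rule: mpoly_induct)
  case (add m a p)
  then show ?case
    by (auto simp: pd_add pd_single lookup_minus lookup_single when_def mult.left_commute
      diff_diff_add add.commute)
qed simp

lemma laplacian_0 [simp]: "laplacian 0 = 0"
  by (simp add: laplacian_def)

lemma laplacian_add: "laplacian (p + q) = laplacian p + laplacian q"
  by (simp add: laplacian_def pd_add sum.distrib)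

lemma laplacian_diff: "laplacian (p - q) = laplacian p - laplacian q"
  by (simp add: laplacian_def pd_diff sum_subtractf)

lemma laplacian_of_nat_mult: "laplacian (of_nat k * p) = of_nat k * laplacian p"
  by (simp add: laplacian_def pd_mult sum_distrib_left)

lemma laplacian_mult:
  "laplacian (p * q) =
    laplacian p * q + 2 * (\<Sum>j\<in>UNIV. pd j p * pd j q) + p * laplacian q"
  by (simp add: laplacian_def pd_mult pd_add sum.distrib sum_distrib_left sum_distrib_right
      algebra_simps)

lemma pd_laplacian: "pd j (laplacian p) = laplacian (pd j p)"
proof -
  have "pd j (pd i (pd i p)) = pd i (pd i (pd j p))" for i
    by (metis pd_commute)
  then show ?thesis by (simp add: laplacian_def pd_sum)
qed

section \<open>Local nilpotency of the Laplacian\<close>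

definition total_degree :: "('n::finite \<Rightarrow>\<^sub>0 nat) \<Rightarrow> nat" where
  "total_degree m = (\<Sum>j\<in>UNIV. Poly_Mapping.lookup m j)"

lemma total_degree_minus_single:
  assumes "0 < Poly_Mapping.lookup m j"
  shows "total_degree (m - Poly_Mapping.single j 1) < total_degree m"
  unfolding total_degree_def using assms
  by (intro sum_strict_mono_strong[where a = j])
     (auto simp: lookup_minus lookup_single when_def)

lemma laplacian_funpow_add:
  "(laplacian ^^ k) (p + q) = (laplacian ^^ k) p + (laplacian ^^ k) q"
  by (induction k) (simp_all add: laplacian_add)

lemma laplacian_funpow_eq_0_mono:
  fixes p :: "('n::finite, 'a::comm_ring_1) mpoly"
  assumes "(laplacian ^^ k) p = 0" "k \<le> l"
  shows "(laplacian ^^ l) p = 0"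
proof -
  have "(laplacian ^^ i) 0 = (0 :: ('n, 'a) mpoly)" for i
    by (induction i) simp_all
  moreover have "(laplacian ^^ l) p = (laplacian ^^ (l - k)) ((laplacian ^^ k) p)"
    using assms(2) by (simp flip: funpow_add[THEN fun_cong, unfolded comp_def])
  ultimately show ?thesis using assms(1) by simp
qed

lemma laplacian_nilpotent_add:
  assumes "\<exists>k. (laplacian ^^ k) p = 0" "\<exists>k. (laplacian ^^ k) q = 0"
  shows "\<exists>k. (laplacian ^^ k) (p + q) = 0"
proof -
  from assms obtain k l where "(laplacian ^^ k) p = 0" "(laplacian ^^ l) q = 0" by blast
  then have "(laplacian ^^ max k l) (p + q) = 0"
    by (simp add: laplacian_funpow_add laplacian_funpow_eq_0_mono[of k p]
      laplacian_funpow_eq_0_mono[of l q])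
  then show ?thesis ..
qed

lemma laplacian_nilpotent_sum:
  assumes "\<And>i. i \<in> I \<Longrightarrow> \<exists>k. (laplacian ^^ k) (f i) = 0"
  shows "\<exists>k. (laplacian ^^ k) (\<Sum>i\<in>I. f i) = 0"
  using assms
proof (induction I rule: infinite_finite_induct)
  case (insert i I)
  then show ?case by (simp add: laplacian_nilpotent_add)
qed (auto intro: exI[of _ 0])

text \<open>Each \<open>pd j (pd j _)\<close> either kills a monomial or lowers its total degree, so
  the Laplacian of a monomial is a finite sum of terms covered by induction; one more application
  handles the monomial itself.\<close>

lemma laplacian_nilpotent_single: "\<exists>k. (laplacian ^^ k) (Poly_Mapping.single m a) = 0"
proof (induction "total_degree m" arbitrary: m a rule: less_induct)
  case less
  have "\<exists>k. (laplacian ^^ k) (pd j (pd j (Poly_Mapping.single m a))) = 0" for j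
  proof (cases "Poly_Mapping.lookup m j \<le> 1")
    \<comment> \<open>With exponent at most 1 the second derivative is already zero, so zero
      applications suffice.\<close>
    case True
    then show ?thesis
      by (intro exI[of _ 0]) (auto simp: pd_single lookup_minus lookup_single)
  next
    case False
    let ?m = "m - Poly_Mapping.single j 1"
    have "total_degree ?m < total_degree m"
      using False by (intro total_degree_minus_single) simp
    moreover have "total_degree (?m - Poly_Mapping.single j 1) < total_degree ?m"
      using False by (intro total_degree_minus_single) (simp add: lookup_minus lookup_single)
    ultimately show ?thesis
      unfolding pd_single by (intro less) simp
  qed
  then have "\<exists>k. (laplacian ^^ k) (laplacian (Poly_Mapping.single m a)) = 0"
    unfolding laplacian_def[of "Poly_Mapping.single m a"] by (intro laplacian_nilpotent_sum)
  then obtain k where "(laplacian ^^ k) (laplacian (Poly_Mapping.single m a)) = 0" ..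
  then have "(laplacian ^^ Suc k) (Poly_Mapping.single m a) = 0"
    by (simp add: funpow_Suc_right del: funpow.simps)
  then show ?case ..
qed

lemma laplacian_nilpotent: "\<exists>k. (laplacian ^^ k) p = 0"
proof (induction p rule: mpoly_induct)
  case zero
  show ?case by (auto intro: exI[of _ 0])
next
  case (add m a p)
  then show ?case by (simp add: laplacian_nilpotent_add laplacian_nilpotent_single)
qed

text \<open>Local nilpotency recast as an induction principle: it replaces induction on the degree,
  and the hypothesis is available exactly at \<open>laplacian p\<close>.\<close>

lemma laplacian_induct [case_names zero laplacian]:
  assumes "P 0" "\<And>p. P (laplacian p) \<Longrightarrow> P p"
  shows "P p"
proof -
  obtain k where "(laplacian ^^ k) p = 0" using laplacian_nilpotent by blast
  then show ?thesis
  proof (induction k arbitrary: p)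
    case (Suc k)
    then have "P (laplacian p)" by (simp add: funpow_Suc_right del: funpow.simps)
    then show ?case by (rule assms(2))
  qed (simp add: assms(1))
qed

section \<open>The Euler operator and its positive shifts\<close>

definition euler :: "('n::finite, 'a::comm_ring_1) mpoly \<Rightarrow> ('n, 'a) mpoly" where
  "euler p = (\<Sum>j\<in>UNIV. Var j * pd j p)"

lemma euler_0 [simp]: "euler 0 = 0"
  by (simp add: euler_def)

lemma euler_add: "euler (p + q) = euler p + euler q"
  by (simp add: euler_def pd_add sum.distrib distrib_left)

lemma euler_diff: "euler (p - q) = euler p - euler q"
  by (simp add: euler_def pd_diff sum_subtractf right_diff_distrib)

lemma pd_euler: "pd k (euler p) = euler (pd k p) + pd k p"
proof -
  have "pd k (Var j * pd j p) = (if k = j then pd j p else 0) + Var j * pd j (pd k p)" for j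
    by (simp add: pd_mult pd_Var pd_commute[of k j])
  then show ?thesis by (simp add: euler_def pd_sum sum.distrib)
qed

lemma euler_sum: "euler (\<Sum>i\<in>I. f i) = (\<Sum>i\<in>I. euler (f i))"
  by (induction I rule: infinite_finite_induct) (simp_all add: euler_add)

text \<open>Commutator of the Laplacian, which lowers degrees by 2, with the operator that
  multiplies by the degree.\<close>

lemma laplacian_euler: "laplacian (euler p) = euler (laplacian p) + 2 * laplacian p"
  by (simp add: laplacian_def pd_euler pd_add euler_sum sum.distrib sum_distrib_left)

lemma euler_single:
  fixes m :: "'n::finite \<Rightarrow>\<^sub>0 nat" and a :: "'a::comm_ring_1"
  shows "euler (Poly_Mapping.single m a) = Poly_Mapping.single m (of_nat (total_degree m) * a)"
proof -
  have "Var j * pd j (Poly_Mapping.single m a)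
      = Poly_Mapping.single m (of_nat (Poly_Mapping.lookup m j) * a)" for j
  proof (cases "Poly_Mapping.lookup m j = 0")
    \<comment> \<open>A positive exponent makes the truncated subtraction exact.\<close>
    case False
    then have "Poly_Mapping.single j 1 + (m - Poly_Mapping.single j 1) = m"
      by (intro poly_mapping_eqI) (auto simp: lookup_add lookup_minus lookup_single when_def)
    then show ?thesis by (simp add: Var_def pd_single mult_single)
  qed (simp add: pd_single)
  moreover have "(\<Sum>j\<in>J. Poly_Mapping.single m (f j)) = Poly_Mapping.single m (\<Sum>j\<in>J. f j)"
    for J and f :: "'n \<Rightarrow> 'a"
    by (induction J rule: infinite_finite_induct) (simp_all add: single_add)
  ultimately show ?thesis
    by (simp add: euler_def total_degree_def sum_distrib_right)
qed

lemma of_nat_mult_single: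
  "of_nat k * Poly_Mapping.single m (a::'a::comm_ring_1) = Poly_Mapping.single m (of_nat k * a)"
  by (simp add: mult_single flip: single_of_nat)

lemma euler_shift_single:
  "of_nat b * euler (Poly_Mapping.single m x) + of_nat a * Poly_Mapping.single m x
    = Poly_Mapping.single m (of_nat (b * total_degree m + a) * x)"
  by (simp add: euler_single of_nat_mult_single single_add algebra_simps)

text \<open>Monomials are eigenvectors of \<open>euler\<close>, so the shifted operator is diagonal
  in the monomial basis.\<close>

lemma lookup_euler_shift:
  "Poly_Mapping.lookup (of_nat b * euler p + of_nat a * p) m
    = of_nat (b * total_degree m + a) * Poly_Mapping.lookup p m"
proof (induction p rule: mpoly_induct)
  case (add n x p)
  have "of_nat b * euler (Poly_Mapping.single n x + p) + of_nat a * (Poly_Mapping.single n x + p)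
    = Poly_Mapping.single n (of_nat (b * total_degree n + a) * x)
      + (of_nat b * euler p + of_nat a * p)"
    unfolding euler_shift_single[symmetric] by (simp add: euler_add algebra_simps)
  then show ?case
    using add by (simp only: lookup_add lookup_single) (auto simp: when_def algebra_simps)
qed simp

lemma rat_embedding_of_nat:
  assumes "rat_embedding \<phi>"
  shows "\<phi> (of_nat k) = of_nat k"
proof (induction k)
  case 0
  have "\<phi> (0 + 0) = \<phi> 0 + \<phi> 0" using assms unfolding rat_embedding_def by blast
  then show ?case by simp
next
  case (Suc k)
  then show ?case using assms by (simp add: rat_embedding_def)
qed

text \<open>The inverse is the image of the rational 1/k. All later appeals to the rationals in the
  coefficient ring come down to this.\<close>

lemma rat_embedding_inverse_of_nat:
  assumes "rat_embedding (\<phi> :: rat \<Rightarrow> 'a::comm_ring_1)" "0 < k"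
  shows "\<exists>y::'a. y * of_nat k = 1"
proof
  have "\<phi> (inverse (of_nat k)) * \<phi> (of_nat k) = \<phi> (inverse (of_nat k) * of_nat k)"
    using assms(1) by (simp add: rat_embedding_def)
  also have "\<dots> = 1" using assms by (simp add: rat_embedding_def)
  finally show "\<phi> (inverse (of_nat k)) * of_nat k = 1"
    by (simp add: rat_embedding_of_nat[OF assms(1)])
qed

text \<open>Every coefficient is multiplied by an integer that is positive because \<open>a\<close>
  is, even for the constant monomial; such an integer is a unit, so zero divisors in the ring do no
  harm.\<close>

lemma euler_shift_inj:
  fixes p :: "('n::finite, 'a::comm_ring_1) mpoly"
  assumes "rat_embedding (\<phi> :: rat \<Rightarrow> 'a)" "0 < a" "of_nat b * euler p + of_nat a * p = 0"
  shows "p = 0"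
proof (rule poly_mapping_eqI)
  fix m :: "'n \<Rightarrow>\<^sub>0 nat"
  obtain y :: 'a where y: "y * of_nat (b * total_degree m + a) = 1"
    using rat_embedding_inverse_of_nat[OF assms(1)] assms(2) by (metis add_gr_0)
  have "of_nat (b * total_degree m + a) * Poly_Mapping.lookup p m = 0"
    by (metis assms(3) lookup_euler_shift lookup_zero)
  then have "y * of_nat (b * total_degree m + a) * Poly_Mapping.lookup p m = 0"
    by (simp only: mult.assoc mult_zero_right)
  then show "Poly_Mapping.lookup p m = Poly_Mapping.lookup 0 m" by (simp only: y) simp
qed

text \<open>A preimage is built monomial by monomial, dividing each coefficient by its positive
  eigenvalue.\<close>

lemma euler_shift_surj:
  fixes f :: "('n::finite, 'a::comm_ring_1) mpoly"
  assumes "rat_embedding (\<phi> :: rat \<Rightarrow> 'a)" "0 < a"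
  shows "\<exists>p. of_nat b * euler p + of_nat a * p = f"
proof (induction f rule: mpoly_induct)
  case zero
  show ?case by (intro exI[of _ 0]) simp
next
  case (add m x f)
  then obtain p where p: "of_nat b * euler p + of_nat a * p = f" ..
  obtain y :: 'a where y: "y * of_nat (b * total_degree m + a) = 1"
    using rat_embedding_inverse_of_nat[OF assms(1)] assms(2) by (metis add_gr_0)
  have "of_nat (b * total_degree m + a) * (y * x) = x"
    using y by (metis mult.assoc mult.commute mult_1)
  then have "of_nat b * euler (Poly_Mapping.single m (y * x) + p)
      + of_nat a * (Poly_Mapping.single m (y * x) + p) = Poly_Mapping.single m x + f"
    using p euler_shift_single[of b m "y * x" a] by (simp add: euler_add algebra_simps)
  then show ?case ..
qed

section \<open>The operators F with sphere polynomial g, and their bijectivity\<close>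

definition sphere_poly :: "'a::comm_ring_1 \<Rightarrow> ('n::finite, 'a) mpoly" where
  "sphere_poly c = (\<Sum>j\<in>UNIV. Var j ^ 2) - Const c"

lemma pd_sphere_poly:
  fixes c :: "'a::comm_ring_1"
  shows "pd j (sphere_poly c) = 2 * Var j"
proof -
  have "pd j (Var k ^ 2 :: (_, 'a) mpoly) = (if j = k then 2 * Var k else 0)" for k
    by (simp add: power2_eq_square pd_mult pd_Var)
  then show ?thesis by (simp add: sphere_poly_def pd_diff pd_sum pd_Const)
qed

text \<open>Product rule: g has Laplacian 2N, and its gradient 2X turns the cross term into 4 times
  the Euler operator.\<close>

lemma laplacian_sphere_poly_mult:
  "laplacian (sphere_poly c * (q :: ('n::finite, 'a::comm_ring_1) mpoly)) =
    sphere_poly c * laplacian q + (of_nat 4 * euler q + of_nat (2 * CARD('n)) * q)"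
proof -
  have "laplacian (sphere_poly c :: ('n, 'a) mpoly) = of_nat (2 * CARD('n))"
    by (simp add: laplacian_def pd_sphere_poly pd_mult pd_Var mult.commute)
  moreover have "2 * (\<Sum>j\<in>UNIV. pd j (sphere_poly c) * pd j q) = of_nat 4 * euler q"
    by (simp add: pd_sphere_poly euler_def sum_distrib_left mult.assoc)
  ultimately show ?thesis by (simp add: laplacian_mult)
qed

text \<open>The parameters are natural numbers, so that positivity makes sense although the ring
  carries no order.\<close>

definition sphere_op ::
    "'a::comm_ring_1 \<Rightarrow> nat \<Rightarrow> nat \<Rightarrow> ('n::finite, 'a) mpoly \<Rightarrow> ('n, 'a) mpoly" where
  "sphere_op c b a q = sphere_poly c * laplacian q + (of_nat b * euler q + of_nat a * q)"

lemma sphere_op_diff: "sphere_op c b a (p - q) = sphere_op c b a p - sphere_op c b a q"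
  by (simp add: sphere_op_def laplacian_diff euler_diff algebra_simps)

text \<open>Moving the Laplacian past g contributes 4 to \<open>b\<close> and 2N to
  \<open>a\<close>; moving it past b times the Euler operator contributes 2b to
  \<open>a\<close>.\<close>

lemma laplacian_sphere_op:
  "laplacian (sphere_op c b a (q :: ('n::finite, 'a::comm_ring_1) mpoly)) =
    sphere_op c (b + 4) (a + 2 * b + 2 * CARD('n)) (laplacian q)"
  unfolding sphere_op_def laplacian_add laplacian_sphere_poly_mult laplacian_of_nat_mult
    laplacian_euler
  by (simp add: algebra_simps)

text \<open>Applying the Laplacian gives an equation of the same kind for
  \<open>laplacian q\<close>, which is therefore zero; then only the injective Euler shift of
  \<open>q\<close> remains. The parameters change along the way, so the induction is over all of
  them.\<close>

lemma sphere_op_inj: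
  fixes q :: "('n::finite, 'a::comm_ring_1) mpoly"
  assumes "rat_embedding (\<phi> :: rat \<Rightarrow> 'a)" "0 < a" "sphere_op c b a q = 0"
  shows "q = 0"
  using assms(2,3)
proof (induction q arbitrary: a b rule: laplacian_induct)
  case (laplacian q)
  have "sphere_op c (b + 4) (a + 2 * b + 2 * CARD('n)) (laplacian q) = 0"
    by (metis laplacian.prems(2) laplacian_0 laplacian_sphere_op)
  then have "laplacian q = 0" by (rule laplacian.IH[rotated]) (simp add: laplacian.prems(1))
  then show ?case
    using euler_shift_inj[OF assms(1) laplacian.prems(1)] laplacian.prems(2)
    by (simp add: sphere_op_def)
qed simp

lemma sphere_op_surj:
  fixes f :: "('n::finite, 'a::comm_ring_1) mpoly"
  assumes "rat_embedding (\<phi> :: rat \<Rightarrow> 'a)" "0 < a"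
  shows "\<exists>q. sphere_op c b a q = f"
  using assms(2)
proof (induction f arbitrary: a b rule: laplacian_induct)
  case zero
  show ?case by (intro exI[of _ 0]) (simp add: sphere_op_def)
next
  case (laplacian f)
  let ?a = "a + 2 * b + 2 * CARD('n)"
  \<comment> \<open>Applying the Laplacian to the desired equation shows which equation
    \<open>laplacian q\<close> must satisfy; \<open>r\<close> is a solution of it, supplied by
    induction.\<close>
  obtain r where r: "sphere_op c (b + 4) ?a r = laplacian f"
    using laplacian by (metis add_gr_0)
  obtain q where q: "of_nat b * euler q + of_nat a * q = f - sphere_poly c * r"
    using euler_shift_surj[OF assms(1) laplacian.prems] by blast
  \<comment> \<open>\<open>q\<close> solves the equation exactly if \<open>\<Delta>q = r\<close>; applying \<open>\<Delta>\<close> to the error shows that it is so.\<close>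
  let ?w = "laplacian q - r"
  have w: "sphere_op c b a q = f + sphere_poly c * ?w"
    unfolding sphere_op_def q by (simp add: algebra_simps)
  have "sphere_op c (b + 4) ?a ?w = laplacian (sphere_poly c * ?w)"
    using arg_cong[OF w, of laplacian]
    by (simp add: laplacian_sphere_op laplacian_add sphere_op_diff r)
  \<comment> \<open>Subtracting the Laplacian of g w removes the second-order term and lowers the
    parameters by 4 and 2N. What is left is an Euler shift with constant a + 2b > 0, so the error
    \<open>?w\<close> vanishes by injectivity.\<close>
  moreover have "of_nat b * euler w + of_nat (a + 2 * b) * w
      = sphere_op c (b + 4) ?a w - laplacian (sphere_poly c * w)"
    for w :: "('n, 'a) mpoly"
    unfolding laplacian_sphere_poly_mult sphere_op_def by (simp add: algebra_simps)
  ultimately have "of_nat b * euler ?w + of_nat (a + 2 * b) * ?w = 0" by simp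
  then have "?w = 0"
    using euler_shift_inj[OF assms(1)] laplacian.prems by (metis add_gr_0)
  with w show ?case by auto
qed

section \<open>Harmonic polynomials as a complement of the sphere ideal\<close>

lemma laplacian_sphere_poly_mult_eq_sphere_op:
  "laplacian (sphere_poly c * (q :: ('n::finite, 'a::comm_ring_1) mpoly)) =
    sphere_op c 4 (2 * CARD('n)) q"
  by (simp add: laplacian_sphere_poly_mult sphere_op_def)

lemma sphere_ideal_iff: "p \<in> sphere_ideal c \<longleftrightarrow> (\<exists>q. p = q * sphere_poly c)"
  by (auto simp: sphere_ideal_eq sphere_poly_def)

lemma harmonic_sphere_ideal_Int:
  fixes p :: "('n::finite, 'a::comm_ring_1) mpoly"
  assumes "rat_embedding (\<phi> :: rat \<Rightarrow> 'a)" "p \<in> harmonic" "p \<in> sphere_ideal c"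
  shows "p = 0"
proof -
  obtain q where q: "p = sphere_poly c * q"
    using assms(3) by (auto simp: sphere_ideal_iff mult.commute)
  then have "sphere_op c 4 (2 * CARD('n)) q = 0"
    using assms(2) by (simp add: harmonic_def flip: laplacian_sphere_poly_mult_eq_sphere_op)
  then have "q = 0" by (rule sphere_op_inj[OF assms(1), rotated]) simp
  with q show ?thesis by simp
qed

text \<open>Surjectivity yields q for which g q and p have the same Laplacian; the harmonic part is
  then p - g q.\<close>

lemma harmonic_sphere_ideal_decomp:
  fixes p :: "('n::finite, 'a::comm_ring_1) mpoly"
  assumes "rat_embedding (\<phi> :: rat \<Rightarrow> 'a)"
  shows "\<exists>h\<in>harmonic. p - h \<in> sphere_ideal c"
proof -
  have "0 < 2 * CARD('n)" by simp
  then obtain q :: "('n, 'a) mpoly" where "sphere_op c 4 (2 * CARD('n)) q = laplacian p"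
    using sphere_op_surj[OF assms] by blast
  then have "p - sphere_poly c * q \<in> harmonic"
    by (simp add: harmonic_def laplacian_diff laplacian_sphere_poly_mult_eq_sphere_op)
  moreover have "p - (p - sphere_poly c * q) \<in> sphere_ideal c"
    by (auto simp: sphere_ideal_iff mult.commute)
  ultimately show ?thesis by blast
qed

section \<open>The rotation operators\<close>

lemma M_op_diff: "M_op j k (p - q) = M_op j k p - M_op j k q"
  by (simp add: M_op_def pd_diff algebra_simps)

text \<open>\<open>M_op j k\<close> is a derivation that kills g, since 2 X_j X_k - 2 X_k X_j =
  0.\<close>

lemma M_op_mult_sphere_poly: "M_op j k (q * sphere_poly c) = M_op j k q * sphere_poly c"
  by (simp add: M_op_def pd_mult pd_sphere_poly algebra_simps)

lemma laplacian_Var_mult: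
  fixes p :: "('n::finite, 'a::comm_ring_1) mpoly"
  shows "laplacian (Var j * p) = Var j * laplacian p + 2 * pd j p"
proof -
  have "(\<Sum>i\<in>UNIV. pd i (Var j) * pd i p) = (\<Sum>i\<in>UNIV. if i = j then pd i p else 0)"
    by (intro sum.cong) (simp_all add: pd_Var)
  moreover have "laplacian (Var j :: ('n, 'a) mpoly) = 0"
    unfolding laplacian_def by (intro sum.neutral) (simp add: pd_Var)
  ultimately show ?thesis by (simp add: laplacian_mult)
qed

text \<open>The two correction terms are twice the mixed partial derivative with opposite
  signs.\<close>

lemma laplacian_M_op: "laplacian (M_op j k p) = M_op j k (laplacian p)"
  by (simp add: M_op_def laplacian_diff laplacian_Var_mult pd_laplacian pd_commute[of j k])

lemma M_op_harmonic: "p \<in> harmonic \<Longrightarrow> M_op j k p \<in> harmonic"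
  by (simp add: harmonic_def laplacian_M_op) (simp add: M_op_def)

lemma M_op_sphere_ideal: "p \<in> sphere_ideal c \<Longrightarrow> M_op j k p \<in> sphere_ideal c"
  by (auto simp: sphere_ideal_iff M_op_mult_sphere_poly)

section \<open>Cosets, the isomorphism and the projection\<close>

lemma coset_eq_iff:
  assumes "module s" "module.subspace s Z"
  shows "p +o Z = q +o Z \<longleftrightarrow> p - q \<in> Z"
proof
  assume "p +o Z = q +o Z"
  moreover have "p \<in> p +o Z"
    using module.subspace_0[OF assms] by (auto simp: elt_set_plus_def intro!: bexI[of _ 0])
  ultimately show "p - q \<in> Z" by (auto simp: elt_set_plus_def)
next
  assume pq: "p - q \<in> Z"
  have sub: "x +o Z \<subseteq> y +o Z" if "x - y \<in> Z" for x y
  proof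
    fix z assume "z \<in> x +o Z"
    then obtain w where "w \<in> Z" "z = y + ((x - y) + w)" by (auto simp: elt_set_plus_def)
    then show "z \<in> y +o Z"
      using module.subspace_add[OF assms that] unfolding elt_set_plus_def by blast
  qed
  have "q - p \<in> Z" using module.subspace_neg[OF assms pq] by simp
  with pq show "p +o Z = q +o Z" by (intro equalityI sub)
qed

theorem proposition5p3:
  fixes \<phi> :: "rat \<Rightarrow> 'a::comm_ring_1" and c :: 'a
  assumes "rat_embedding \<phi>"
    and "CARD('n::finite) \<ge> 2"
  shows "module_iso_on scale (harmonic :: ('n, 'a) mpoly set)
           (coset_scale scale (sphere_ideal c)) (cosets (sphere_ideal c)) (H_map c) \<and>
         (\<exists>!L. harmonic_projection c (L :: ('n, 'a) mpoly \<Rightarrow> ('n, 'a) mpoly)) \<and>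
         (\<forall>L :: ('n, 'a) mpoly \<Rightarrow> ('n, 'a) mpoly. harmonic_projection c L \<longrightarrow>
            {p. L p = 0} = sphere_ideal c \<and>
            (\<forall>p. H_map c (L p) = p +o sphere_ideal c) \<and>
            (\<forall>j k p. j \<noteq> k \<longrightarrow> L (M_op j k p) = M_op j k (L p)))"
proof -
  let ?H = "harmonic :: ('n, 'a) mpoly set" and ?Z = "sphere_ideal c :: ('n, 'a) mpoly set"
  note H = module.subspace_diff[OF module_scale subspace_harmonic]
    module.subspace_add[OF module_scale subspace_harmonic]
    module.subspace_scale[OF module_scale subspace_harmonic]
  note Z = module.subspace_diff[OF module_scale subspace_sphere_ideal]
    module.subspace_add[OF module_scale subspace_sphere_ideal]
    module.subspace_scale[OF module_scale subspace_sphere_ideal]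
    module.subspace_0[OF module_scale subspace_sphere_ideal]
  note coset_eq = coset_eq_iff[OF module_scale subspace_sphere_ideal]
  \<comment> \<open>Two harmonic parts of the same \<open>p\<close> differ by a harmonic element of
    the ideal, hence by 0. The later identities between harmonic polynomials follow by exhibiting
    both sides as harmonic parts of one polynomial.\<close>
  have uniq: "h = h'" if "h \<in> ?H" "h' \<in> ?H" "p - h \<in> ?Z" "p - h' \<in> ?Z" for p h h'
  proof -
    have "(p - h') - (p - h) \<in> ?Z" using that Z(1) by blast
    then show ?thesis
      using harmonic_sphere_ideal_Int[OF assms(1)] H(1)[OF that(1,2)] by force
  qed
  have iso: "module_iso_on scale ?H (coset_scale scale ?Z) (cosets ?Z) (H_map c)"
    unfolding module_iso_on_def bij_betw_def
  proof (intro conjI ballI allI)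
    show "inj_on (H_map c) ?H"
    proof (rule inj_onI)
      fix x y assume "x \<in> ?H" "y \<in> ?H" "H_map c x = H_map c y"
      then show "x = y" using uniq[of x y x] by (simp add: H_map_def coset_eq Z(4))
    qed
    show "H_map c ` ?H = cosets ?Z"
    proof
      show "H_map c ` ?H \<subseteq> cosets ?Z" by (auto simp: H_map_def cosets_def)
      show "cosets ?Z \<subseteq> H_map c ` ?H"
      proof
        fix A assume "A \<in> cosets ?Z"
        then obtain p where A: "A = p +o ?Z" by (auto simp: cosets_def)
        obtain h where "h \<in> ?H" "p - h \<in> ?Z"
          using harmonic_sphere_ideal_decomp[OF assms(1)] by blast
        then show "A \<in> H_map c ` ?H" by (auto simp: A H_map_def coset_eq)
      qed
    qed
  qed (simp_all add: H_map_def coset_add[OF module_scale subspace_sphere_ideal]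
      coset_scale_coset[OF module_scale subspace_sphere_ideal])
  \<comment> \<open>Evaluating \<open>L\<close> on h + (p - h) forces its value at \<open>p\<close>
    to be the harmonic part; this gives uniqueness and properties (i) to (iii).\<close>
  have proj: "L p \<in> ?H" "p - L p \<in> ?Z" if L: "harmonic_projection c L" for L p
  proof -
    obtain h where h: "h \<in> ?H" "p - h \<in> ?Z"
      using harmonic_sphere_ideal_decomp[OF assms(1)] by blast
    have "L (h + (p - h)) = L h + L (p - h)"
      using L unfolding harmonic_projection_def by (blast dest: module_hom.add)
    then have "L p = h" using L h by (simp add: harmonic_projection_def)
    with h show "L p \<in> ?H" "p - L p \<in> ?Z" by simp_all
  qed
  have ex1: "\<exists>!L. harmonic_projection c (L :: ('n, 'a) mpoly \<Rightarrow> ('n, 'a) mpoly)"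
  proof (rule ex_ex1I)
    have "\<forall>p. \<exists>h. h \<in> ?H \<and> p - h \<in> ?Z"
      using harmonic_sphere_ideal_decomp[OF assms(1)] by blast
    \<comment> \<open>\<open>L\<close> is chosen pointwise; its linearity is then a consequence of
      \<open>uniq\<close>.\<close>
    then obtain L where L: "L p \<in> ?H" "p - L p \<in> ?Z" for p by metis
    have "L (p + q) = L p + L q" for p q
    proof (rule uniq[of _ _ "p + q"])
      show "p + q - (L p + L q) \<in> ?Z"
        using Z(2)[OF L(2)[of p] L(2)[of q]] by (simp add: algebra_simps)
    qed (simp_all add: L H)
    moreover have "L (scale r p) = scale r (L p)" for r p
    proof (rule uniq[of _ _ "scale r p"])
      show "scale r p - scale r (L p) \<in> ?Z"
        using Z(3)[OF L(2)[of p]] by (simp add: module.scale_right_diff_distrib[OF module_scale])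
    qed (simp_all add: L H)
    ultimately have "module_hom scale scale L"
      by (intro module_hom.intro module_scale module_hom_axioms.intro)
    moreover have "L p = p" if "p \<in> ?H" for p
      using uniq[of "L p" p p] that L by (simp add: Z(4))
    moreover have "L p = 0" if "p \<in> ?Z" for p
      using uniq[of "L p" 0 p] that L by (simp add: harmonic_def)
    ultimately show "\<exists>L. harmonic_projection c (L :: ('n, 'a) mpoly \<Rightarrow> ('n, 'a) mpoly)"
      using L(1) unfolding harmonic_projection_def by blast
  next
    fix L L' :: "('n, 'a) mpoly \<Rightarrow> ('n, 'a) mpoly"
    assume "harmonic_projection c L" "harmonic_projection c L'"
    then show "L = L'" using uniq proj by blast
  qed
  have props: "{p. L p = 0} = ?Z \<and> (\<forall>p. H_map c (L p) = p +o ?Z) \<and>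
      (\<forall>j k p. j \<noteq> k \<longrightarrow> L (M_op j k p) = M_op j k (L p))"
    if L: "harmonic_projection c L" for L
  proof (intro conjI allI impI)
    have "p \<in> ?Z" if "L p = 0" for p
      using proj(2)[OF L, of p] that by simp
    then show "{p. L p = 0} = ?Z"
      using L unfolding harmonic_projection_def by blast
    show "H_map c (L p) = p +o ?Z" for p
      using proj(2)[OF L, of p] unfolding H_map_def by (metis coset_eq)
    \<comment> \<open>Both sides are harmonic parts of \<open>M_op j k p\<close>, because
      \<open>M_op j k\<close> preserves the harmonic polynomials and the ideal.\<close>
    show "L (M_op j k p) = M_op j k (L p)" for j k p
    proof (rule uniq)
      show "M_op j k p - M_op j k (L p) \<in> ?Z"
        using M_op_sphere_ideal[OF proj(2)[OF L, of p], of j k]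
        by (simp add: M_op_diff)
    qed (auto intro: M_op_harmonic proj[OF L])
  qed
  from iso ex1 props show ?thesis by blast
qed

end
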